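(* If $\mathfrak{r}=\mathfrak{c}$ then $\mathfrak{s}\leq\operatorname{cf}(\mathfrak{c})$. Moreover, if $\mathfrak{r}_\sigma=\mathfrak{c}$ then $\mathfrak{s}\leq\operatorname{cf}(\mathfrak{c})$.
   Context: For $B\in[\omega]^\omega$ and $S\subseteq\omega$, $S$ splits $B$ if $S\cap B$ and $(\omega\setminus S)\cap B$ are both infinite. The reaping number $\mathfrak{r}$ is the minimal cardinality of a family $\mathcal{T}\subseteq[\omega]^\omega$ such that no single $S\in[\omega]^\omega$ splits every member of $\mathcal{T}$. $\mathfrak{r}_\sigma$ is the minimal cardinality of a family $\mathcal{R}\subseteq[\omega]^\omega$ such that there is no countable family $\{S_n:n\in\omega\}$ of subsets of $\omega$ with every member of $\mathcal{R}$ split by some $S_n$. The splitting number $\mathfrak{s}$ is the minimal cardinality of a family $\mathcal{S}$ of subsets of $\omega$ such that every $B\in[\omega]^\omega$ is split by some member of $\mathcal{S}$. $\mathfrak{c}=2^{\aleph_0}$. *)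

theory Defs
  imports Complex_Main "HOL-Library.Infinite_Set" "HOL-Library.Diagonal_Subsequence"
begin

unbundle cardinal_syntax

text \<open>
  Cardinals are represented as in the library, by minimal well-orders
  (\<^const>\<open>card_of\<close>), and compared with \<open>=o\<close> and \<open>\<le>o\<close>.
\<close>

definition splits :: "nat set \<Rightarrow> nat set \<Rightarrow> bool" where
  "splits S B \<longleftrightarrow> infinite (S \<inter> B) \<and> infinite ((UNIV - S) \<inter> B)"

text \<open>
  The least cardinality of a set satisfying \<open>P\<close>. It is meaningful only if some set satisfies
  \<open>P\<close>; this is shown below in each case where the definition is used.
\<close>

definition min_card :: "('a set \<Rightarrow> bool) \<Rightarrow> 'a rel" where
  "min_card P = |SOME A. P A \<and> (\<forall>B. P B \<longrightarrow> |A| \<le>o |B| )|"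

definition reaping_family :: "nat set set \<Rightarrow> bool" where
  "reaping_family T \<longleftrightarrow>
    (\<forall>B\<in>T. infinite B) \<and> \<not> (\<exists>S. infinite S \<and> (\<forall>B\<in>T. splits S B))"

definition sigma_reaping_family :: "nat set set \<Rightarrow> bool" where
  "sigma_reaping_family R \<longleftrightarrow>
    (\<forall>B\<in>R. infinite B) \<and> \<not> (\<exists>S :: nat \<Rightarrow> nat set. \<forall>B\<in>R. \<exists>n. splits (S n) B)"

definition splitting_family :: "nat set set \<Rightarrow> bool" where
  "splitting_family F \<longleftrightarrow> (\<forall>B. infinite B \<longrightarrow> (\<exists>S\<in>F. splits S B))"

definition reaping_number :: "nat set rel" where
  "reaping_number = min_card reaping_family"

definition sigma_reaping_number :: "nat set rel" where
  "sigma_reaping_number = min_card sigma_reaping_family"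

definition splitting_number :: "nat set rel" where
  "splitting_number = min_card splitting_family"

definition continuum :: "(nat \<Rightarrow> bool) rel" where
  "continuum = ctwo ^c natLeq"

text \<open>
  \<^const>\<open>cofinal\<close> asks for a strict upper bound in \<open>A\<close> of every element; for an infinite
  cardinal \<open>r\<close>, which has no largest element, this is cofinality in the usual sense.
\<close>

definition cofinality :: "'a rel \<Rightarrow> 'a rel" where
  "cofinality r = min_card (\<lambda>A. A \<subseteq> Field r \<and> cofinal A r)"

lemma min_card_attained:
  assumes "P A"
  obtains B where "P B" "min_card P = |B|" "\<And>C. P C \<Longrightarrow> |B| \<le>o |C|"
proof -
  have "\<exists>r\<in>{ |C| | C. P C}. \<forall>r'\<in>{ |C| | C. P C}. r \<le>o r'"
    using assms by (intro exists_minim_Card_order) (auto intro: card_of_Card_order)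
  then have ex: "\<exists>B. P B \<and> (\<forall>C. P C \<longrightarrow> |B| \<le>o |C| )"
    by blast
  show thesis
    using someI_ex[OF ex] that unfolding min_card_def by blast
qed

lemma reaping_family_infinite_sets: "reaping_family {B. infinite B}"
proof -
  have "\<not> splits S S" for S
    by (simp add: splits_def Diff_Int_distrib2)
  then show ?thesis
    unfolding reaping_family_def by blast
qed

lemma splitting_family_UNIV: "splitting_family UNIV"
  unfolding splitting_family_def
proof (intro allI impI)
  fix B :: "nat set"
  assume B: "infinite B"
  obtain e :: "nat \<Rightarrow> nat" where e: "strict_mono e" and eB: "\<And>n. e n \<in> B"
    using infinite_enumerate[OF B] by blast
  have inj: "inj e"
    using e by (rule strict_mono_imp_inj_on)
  have "infinite (range (\<lambda>n. e (2 * n)))" "infinite (range (\<lambda>n. e (2 * n + 1)))"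
    using inj by (auto intro!: range_inj_infinite injI simp: inj_eq)
  moreover have "range (\<lambda>n. e (2 * n)) \<subseteq> range (\<lambda>n. e (2 * n)) \<inter> B"
    using eB by auto
  moreover have "range (\<lambda>n. e (2 * n + 1)) \<subseteq> (UNIV - range (\<lambda>n. e (2 * n))) \<inter> B"
  proof (intro subsetI IntI DiffI UNIV_I notI)
    fix x assume "x \<in> range (\<lambda>n. e (2 * n + 1))"
    then obtain m where m: "x = e (2 * m + 1)" by blast
    then show "x \<in> B" using eB by simp
    assume "x \<in> range (\<lambda>n. e (2 * n))"
    then obtain n where "x = e (2 * n)" by blast
    with m inj have "2 * m + 1 = 2 * n" by (simp add: inj_eq)
    then show False by presburger
  qed
  ultimately have "splits (range (\<lambda>n. e (2 * n))) B"
    unfolding splits_def using infinite_super by blast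
  then show "\<exists>S\<in>UNIV. splits S B" by blast
qed

lemma ex_infinite_unsplit:
  fixes S :: "nat \<Rightarrow> nat set"
  shows "\<exists>B. infinite B \<and> (\<forall>n. \<not> splits (S n) B)"
proof -
  define P where "P n s \<longleftrightarrow> (\<forall>i. s i \<in> S n) \<or> (\<forall>i. s i \<notin> S n)"
    for n and s :: "nat \<Rightarrow> nat"
  interpret subseqs P
  proof
    fix n and s :: "nat \<Rightarrow> nat"
    have "infinite {i. s i \<in> S n} \<or> infinite {i. s i \<notin> S n}"
    proof -
      have "{i. s i \<in> S n} \<union> {i. s i \<notin> S n} = UNIV" by blast
      then show ?thesis using infinite_UNIV_nat finite_UnI by metis
    qed
    then show "\<exists>r'. strict_mono r' \<and> P n (s \<circ> r')"
    proof
      assume "infinite {i. s i \<in> S n}"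
      then show ?thesis
        using infinite_enumerate[of "{i. s i \<in> S n}"] by (auto simp: P_def)
    next
      assume "infinite {i. s i \<notin> S n}"
      then show ?thesis
        using infinite_enumerate[of "{i. s i \<notin> S n}"] by (auto simp: P_def)
    qed
  qed
  have inf: "infinite (range diagseq)"
    using subseq_diagseq by (intro range_inj_infinite strict_mono_imp_inj_on)
  have "\<not> splits (S k) (range diagseq)" for k
  proof -
    have "P k (diagseq \<circ> ((+) (Suc k)))"
      by (rule diagseq_holds) (auto simp: P_def)
    then have P: "(\<forall>j. diagseq (Suc k + j) \<in> S k) \<or> (\<forall>j. diagseq (Suc k + j) \<notin> S k)"
      by (simp add: P_def)
    have "\<exists>j. i = Suc k + j" if "i > k" for i
      using that by presburger
    with P have "(\<forall>i>k. diagseq i \<in> S k) \<or> (\<forall>i>k. diagseq i \<notin> S k)"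
      by blast
    then have "(UNIV - S k) \<inter> range diagseq \<subseteq> diagseq ` {..k} \<or>
        S k \<inter> range diagseq \<subseteq> diagseq ` {..k}"
    proof
      assume "\<forall>i>k. diagseq i \<in> S k"
      then have "(UNIV - S k) \<inter> range diagseq \<subseteq> diagseq ` {..k}"
        using not_le by blast
      then show ?thesis ..
    next
      assume "\<forall>i>k. diagseq i \<notin> S k"
      then have "S k \<inter> range diagseq \<subseteq> diagseq ` {..k}"
        using not_le by blast
      then show ?thesis ..
    qed
    then show ?thesis
      unfolding splits_def using finite_subset by blast
  qed
  with inf show ?thesis by blast
qed

lemma sigma_reaping_family_infinite_sets: "sigma_reaping_family {B. infinite B}"
  unfolding sigma_reaping_family_def
proof (intro conjI notI)
  show "\<forall>B\<in>{B. infinite B}. infinite B" by simp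
next
  assume "\<exists>S :: nat \<Rightarrow> nat set. \<forall>B\<in>{B. infinite B}. \<exists>n. splits (S n) B"
  then obtain S :: "nat \<Rightarrow> nat set" where S: "\<And>B. infinite B \<Longrightarrow> \<exists>n. splits (S n) B"
    by auto
  obtain B where "infinite B" "\<forall>n. \<not> splits (S n) B"
    using ex_infinite_unsplit[of S] by (elim exE conjE)
  with S[of B] show False by simp
qed

lemma cofinal_Field:
  assumes "Card_order r" "infinite (Field r)"
  shows "cofinal (Field r) r"
  unfolding cofinal_def using infinite_Card_order_limit[OF assms] by simp

lemma cofinal_continuum: "cofinal (Field continuum) continuum"
proof (rule cofinal_Field)
  show "Card_order continuum"
    by (simp add: continuum_def Card_order_cexp)
  show "infinite (Field continuum)"
    using cinfinite_cexp[OF ordLeq_refl[OF Card_order_ctwo] natLeq_Cinfinite]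
    by (simp add: continuum_def cinfinite_def)
qed

end

theory Submission
  imports Defs
begin

text \<open>
  Enumerate the infinite sets of naturals in order type \<open>\<cc>\<close> and cut the enumeration
  at a cofinal set of \<open>cf(\<cc>)\<close> points. Each initial segment has fewer than \<open>\<cc>\<close> members,
  so it is not \<open>\<sigma>\<close>-reaping and countably many sets split all its members. The
  \<open>cf(\<cc>) \<cdot> \<aleph>\<^sub>0 = cf(\<cc>)\<close> sets obtained in this way form a splitting family. If
  already \<open>\<rr> = \<cc>\<close>, a single set splits all members of an initial segment.
\<close>

text \<open>Both the base and the exponent have full fields, so the function space
  \<open>Func\<close> omits nothing. Hence every characteristic function is a point of the
  well-order.\<close>

lemma Field_continuum: "Field continuum = UNIV"
  by (auto simp: continuum_def cexp_def ctwo_def Func_def Field_natLeq Field_card_of)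

lemma Card_order_continuum: "Card_order continuum"
  by (simp add: continuum_def Card_order_cexp)

lemma finite_subset_bounded:
  assumes "Well_order r" "Field r \<noteq> {}" "finite A" "A \<subseteq> Field r"
  shows "\<exists>m\<in>Field r. \<forall>a\<in>A. (a, m) \<in> r"
  using assms(3,4)
proof (induction A rule: finite_induct)
  case empty
  then show ?case using assms(2) by blast
next
  case (insert x A)
  then obtain m where m: "m \<in> Field r" "\<forall>a\<in>A. (a, m) \<in> r" by blast
  have refl: "Refl r" and trans: "trans r" and total: "Total r"
    using assms(1) by (auto simp: order_on_defs)
  have x: "x \<in> Field r" using insert.prems by blast
  \<comment> \<open>\<open>Total\<close> compares distinct elements only; reflexivity covers x =
    m.\<close>
  have "(x, m) \<in> r \<or> (m, x) \<in> r"
    using total refl m(1) x unfolding total_on_def refl_on_def by metis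
  then show ?case
  proof
    assume "(x, m) \<in> r"
    with m show ?thesis by blast
  next
    assume "(m, x) \<in> r"
    with m(2) trans have "\<forall>a\<in>A. (a, x) \<in> r" by (meson transD)
    with x refl show ?thesis by (auto dest: refl_onD)
  qed
qed

text \<open>A finite subset has an upper bound m in the field, and antisymmetry rules out the
  element strictly above m that \<open>cofinal\<close> demands. Infinitude of A later absorbs the
  countable factor.\<close>

lemma cofinal_infinite:
  assumes "Well_order r" "Field r \<noteq> {}" "A \<subseteq> Field r" "cofinal A r"
  shows "infinite A"
proof
  assume "finite A"
  from finite_subset_bounded[OF assms(1,2) this assms(3)]
  obtain m where m: "m \<in> Field r" "\<forall>a\<in>A. (a, m) \<in> r" by blast
  from assms(4) m(1) obtain b where "b \<in> A" "m \<noteq> b" "(m, b) \<in> r"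
    unfolding cofinal_def by blast
  moreover have "antisym r" using assms(1) by (simp add: order_on_defs)
  ultimately show False using m(2) by (meson antisymD)
qed

lemma less_min_card_imp_not:
  assumes "P A" "|X| <o min_card P"
  shows "\<not> P X"
  using assms(1)
proof (rule min_card_attained)
  fix B assume "min_card P = |B|" "\<And>C. P C \<Longrightarrow> |B| \<le>o |C|"
  then show ?thesis using assms(2) not_ordLess_ordLeq by metis
qed

lemma min_card_le:
  assumes "P A"
  shows "min_card P \<le>o |A|"
  using assms by (rule min_card_attained) (use assms in metis)

text \<open>The hypothesis \<open>small\<close> is what both cardinal equations yield, so one
  argument serves both implications.\<close>

lemma splitting_number_le_cofinality:
  assumes small: "\<And>X. |X| <o continuum \<Longrightarrow> \<forall>B\<in>X. infinite B \<Longrightarrow>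
    \<exists>S :: nat \<Rightarrow> nat set. \<forall>B\<in>X. \<exists>n. splits (S n) B"
  shows "splitting_number \<le>o cofinality continuum"
proof -
  let ?c = continuum
  obtain A where A: "A \<subseteq> Field ?c" "cofinal A ?c" and cof: "cofinality ?c = |A|"
  proof (rule min_card_attained[of "\<lambda>A. A \<subseteq> Field ?c \<and> cofinal A ?c" "Field ?c"])
    show "Field ?c \<subseteq> Field ?c \<and> cofinal (Field ?c) ?c"
      using cofinal_continuum by simp
  qed (unfold cofinality_def, blast)
  have wo: "Well_order ?c"
    using Card_order_continuum by (rule card_order_on_well_order_on)
  have inf: "infinite A"
    by (rule cofinal_infinite[OF wo _ A]) (simp add: Field_continuum)
  \<comment> \<open>The well-order lives on predicates, so \<open>f\<close> passes to characteristic
    functions and thereby enumerates the sets. \<open>X a\<close> collects the infinite sets placed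
    strictly before a.\<close>
  define f :: "nat set \<Rightarrow> nat \<Rightarrow> bool" where "f B = (\<lambda>n. n \<in> B)" for B
  define X where "X a = {B. infinite B \<and> f B \<in> underS ?c a}" for a
  have inj: "inj_on f Y" for Y by (auto simp: inj_on_def f_def fun_eq_iff)
  have "|X a| <o ?c" for a
  proof -
    have "|X a| \<le>o |underS ?c a|"
      using inj by (auto simp: card_of_ordLeq[symmetric] X_def)
    moreover have "|underS ?c a| <o ?c"
      by (rule card_of_underS[OF Card_order_continuum]) (simp add: Field_continuum)
    ultimately show ?thesis by (rule ordLeq_ordLess_trans)
  qed
  then have "\<exists>S :: nat \<Rightarrow> nat set. \<forall>B\<in>X a. \<exists>n. splits (S n) B" for a
    by (rule small) (simp add: X_def)
  then obtain S :: "(nat \<Rightarrow> bool) \<Rightarrow> nat \<Rightarrow> nat set"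
    where S: "\<And>a B. B \<in> X a \<Longrightarrow> \<exists>n. splits (S a n) B" by metis
  define F where "F = (\<Union>a\<in>A. range (S a))"
  have "splitting_family F"
    unfolding splitting_family_def
  proof (intro allI impI)
    fix B :: "nat set" assume B: "infinite B"
    \<comment> \<open>The bound a is strict, as membership in \<open>underS\<close>
      requires.\<close>
    obtain a where "a \<in> A" "f B \<noteq> a" "(f B, a) \<in> ?c"
      using A(2) unfolding cofinal_def by (auto simp: Field_continuum)
    then have "B \<in> X a" using B by (simp add: X_def underS_def)
    with \<open>a \<in> A\<close> show "\<exists>T\<in>F. splits T B" using S unfolding F_def by blast
  qed
  then have "splitting_number \<le>o |F|"
    unfolding splitting_number_def by (rule min_card_le)
  also have "|F| \<le>o |A|"
    unfolding F_def
  \<comment> \<open>A union over an infinite index set A of sets of size at most |A| has size at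
    most |A|; here each of them is countable.\<close>
  proof (rule card_of_UNION_ordLeq_infinite[OF inf])
    show "|A| \<le>o |A|" by (rule ordLeq_refl[OF card_of_Card_order])
    have "|UNIV :: nat set| \<le>o |A|"
      using inf infinite_iff_card_of_nat by blast
    then show "\<forall>a\<in>A. |range (S a)| \<le>o |A|"
      using card_of_image ordLeq_transitive by blast
  qed
  finally show ?thesis by (simp add: cof)
qed

theorem theorem2p7:
  shows "(reaping_number =o continuum \<longrightarrow> splitting_number \<le>o cofinality continuum) \<and>
    (sigma_reaping_number =o continuum \<longrightarrow> splitting_number \<le>o cofinality continuum)"
proof (intro conjI impI; rule splitting_number_le_cofinality)
  fix X :: "nat set set"
  assume r: "reaping_number =o continuum" and X: "|X| <o continuum" "\<forall>B\<in>X. infinite B"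
  have "|X| <o min_card reaping_family"
    using ordLess_ordIso_trans[OF X(1) ordIso_symmetric[OF r]] by (simp add: reaping_number_def)
  from less_min_card_imp_not[of reaping_family, OF reaping_family_infinite_sets this]
  obtain S where "\<forall>B\<in>X. splits S B"
    using X(2) by (auto simp: reaping_family_def)
  \<comment> \<open>A single splitting set is read as a constant sequence.\<close>
  then have "\<forall>B\<in>X. \<exists>n::nat. splits ((\<lambda>_. S) n) B" by simp
  then show "\<exists>S :: nat \<Rightarrow> nat set. \<forall>B\<in>X. \<exists>n. splits (S n) B"
    by (intro exI[of _ "\<lambda>_. S"])
next
  fix X :: "nat set set"
  assume r: "sigma_reaping_number =o continuum"
    and X: "|X| <o continuum" "\<forall>B\<in>X. infinite B"
  have "|X| <o min_card sigma_reaping_family"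
    using ordLess_ordIso_trans[OF X(1) ordIso_symmetric[OF r]]
    by (simp add: sigma_reaping_number_def)
  from less_min_card_imp_not[of sigma_reaping_family, OF sigma_reaping_family_infinite_sets this]
  show "\<exists>S :: nat \<Rightarrow> nat set. \<forall>B\<in>X. \<exists>n. splits (S n) B"
    using X(2) by (simp add: sigma_reaping_family_def)
qed

end
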